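(* Let $s_1,s_2\in\mathbb{R}$, $0<p_1,p_2<\infty$, $0<q_1,q_2\le\infty$ and $\alpha\in\mathbb{R}$. For $\Gamma\subset\mathcal{D}$ (the dyadic cubes of $\mathbb{R}^d$) define $\nu_\alpha(\Gamma)=\sum_{Q\in\Gamma}|Q|^\alpha$. Then $$\Big\|\sum_{Q\in\Gamma}\frac{\mathbf{e}_Q}{\|\mathbf{e}_Q\|_{f^{s_2}_{p_2,q_2}}}\Big\|_{f^{s_1}_{p_1,q_1}}\approx[\nu_\alpha(\Gamma)]^{1/p_1}$$ holds for all $\Gamma\subset\mathcal{D}$ with $\nu_\alpha(\Gamma)<\infty$ (with constants independent of $\Gamma$) if and only if one of the following holds: (i) $\alpha\ne1$ and $\alpha=p_1\big(\frac{s_2-s_1}{d}-\frac1{p_2}\big)+1$; or (ii) $\alpha=1$, $\frac{s_2-s_1}{d}=\frac1{p_2}$ and $p_1=q_1$.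
   Context: $\mathcal{D}$ is the set of dyadic cubes $Q_{j,k}=2^{-j}([0,1)^d+k)$, $j\in\mathbb{Z}$, $k\in\mathbb{Z}^d$, of $\mathbb{R}^d$; $|Q|$ is the Lebesgue measure of $Q$. $\mathbf{e}_Q$ is the sequence indexed by $\mathcal{D}$ with entry $1$ at $Q$ and $0$ elsewhere; $\sum_{Q\in\Gamma}c_Q\mathbf{e}_Q$ denotes the sequence with entry $c_Q$ for $Q\in\Gamma$ and $0$ otherwise ($\Gamma$ may be infinite; no convergence is meant). For $s\in\mathbb{R}$, $0<p<\infty$, $0<r\le\infty$, $f^s_{p,r}$ is the space of complex sequences $\mathbf{s}=\{s_Q\}_{Q\in\mathcal{D}}$ with $$\|\mathbf{s}\|_{f^s_{p,r}}=\Big\|\Big[\sum_{Q\in\mathcal{D}}\big(|Q|^{-s/d+1/r-1/2}|s_Q|\chi^{(r)}_Q(\cdot)\big)^r\Big]^{1/r}\Big\|_{L^p(\mathbb{R}^d)}<\infty,$$ where $\chi^{(r)}_Q=\chi_Q|Q|^{-1/r}$ and $\chi_Q$ is the characteristic function of $Q$ (for $r=\infty$ the inner $\ell^r$ sum is replaced by a supremum, with $1/r=0$). The quasi-norm is taken to be $\infty$ for sequences not in the space. $A\approx B$ means $C^{-1}B\le A\le CB$ with a constant $C>0$ independent of $\Gamma$. *)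

theory Defs
  imports "HOL-Analysis.Analysis"
begin

definition dyadic_cube :: "int \<Rightarrow> int ^ 'd \<Rightarrow> (real ^ 'd) set" where
  "dyadic_cube j k =
     (\<lambda>x. 2 powi (- j) *\<^sub>R (x + (\<chi> i. of_int (k $ i)))) ` {x. \<forall>i. 0 \<le> x $ i \<and> x $ i < 1}"

definition dyadic_cubes :: "(real ^ 'd) set set" where
  "dyadic_cubes = {dyadic_cube j k | j k. True}"

abbreviation vol :: "(real ^ 'd) set \<Rightarrow> real" where
  "vol Q \<equiv> measure lborel Q"

text \<open>
  Real powers on \<open>[0, \<infinity>]\<close>. The value \<open>\<infinity>\<close> at the base \<open>\<infinity>\<close> is the usual one for positive
  exponents, and only positive exponents are used below.
\<close>

definition ennpowr :: "ennreal \<Rightarrow> real \<Rightarrow> ennreal" where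
  "ennpowr x a = (if x = \<infinity> then \<infinity> else ennreal (enn2real x powr a))"

text \<open>
  Indices in \<open>(0, \<infinity>]\<close> have type \<^typ>\<open>ennreal\<close>. The reciprocal as a real number follows the
  convention \<open>1/\<infinity> = 0\<close>.
\<close>

definition recip :: "ennreal \<Rightarrow> real" where
  "recip r = enn2real (1 / r)"

text \<open>The \<open>\<ell>\<^sup>r\<close> quasi-norm of a nonnegative family, with the supremum for \<open>r = \<infinity>\<close>.\<close>

definition ell_norm :: "ennreal \<Rightarrow> 'i set \<Rightarrow> ('i \<Rightarrow> real) \<Rightarrow> ennreal" where
  "ell_norm r I a =
     (if r = \<infinity> then (SUP i\<in>I. ennreal (a i))
      else ennpowr (\<Sum>\<^sub>\<infinity>i\<in>I. ennreal (a i powr enn2real r)) (1 / enn2real r))"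

definition Lp_norm :: "real \<Rightarrow> (real ^ 'd \<Rightarrow> ennreal) \<Rightarrow> ennreal" where
  "Lp_norm p f = ennpowr (\<integral>\<^sup>+ x. ennpowr (f x) p \<partial>lborel) (1 / p)"

text \<open>The characteristic function \<open>\<chi>\<^sub>Q |Q|\<^bsup>-1/r\<^esup>\<close>.\<close>

definition chi :: "ennreal \<Rightarrow> (real ^ 'd) set \<Rightarrow> real ^ 'd \<Rightarrow> real" where
  "chi r Q x = indicator Q x * vol Q powr (- recip r)"

text \<open>
  The quasi-norm of \<open>f\<^sup>s\<^bsub>p,r\<^esub>\<close>. A sequence indexed by the dyadic cubes is a function on all sets,
  of which only the values at dyadic cubes matter; it belongs to the space exactly if the value
  below is not \<open>\<infinity>\<close>.
\<close>

definition fnorm :: "real \<Rightarrow> real \<Rightarrow> ennreal \<Rightarrow> ((real ^ 'd) set \<Rightarrow> complex) \<Rightarrow> ennreal" where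
  "fnorm s p r u =
     Lp_norm p (\<lambda>x. ell_norm r dyadic_cubes
       (\<lambda>Q. vol Q powr (- s / real CARD('d) + recip r - 1 / 2) * norm (u Q) * chi r Q x))"

definition unit_seq :: "(real ^ 'd) set \<Rightarrow> (real ^ 'd) set \<Rightarrow> complex" where
  "unit_seq Q = (\<lambda>R. if R = Q then 1 else 0)"

text \<open>The formal sum of \<open>c\<^sub>Q e\<^sub>Q\<close> over \<open>Q \<in> \<Gamma>\<close>.\<close>

definition formal_sum ::
    "(real ^ 'd) set set \<Rightarrow> ((real ^ 'd) set \<Rightarrow> complex) \<Rightarrow> (real ^ 'd) set \<Rightarrow> complex" where
  "formal_sum \<Gamma> c = (\<lambda>Q. if Q \<in> \<Gamma> then c Q else 0)"

definition nu :: "real \<Rightarrow> (real ^ 'd) set set \<Rightarrow> ennreal" where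
  "nu \<alpha> \<Gamma> = (\<Sum>\<^sub>\<infinity>Q\<in>\<Gamma>. ennreal (vol Q powr \<alpha>))"

end

theory Submission
  imports Defs
begin

text \<open>
  With \<open>\<beta> = (s2 - s1)/d - 1/p2\<close>, the norm of the normalized sum over \<open>\<Gamma>\<close> is the \<open>L\<^bsup>p1\<^esup>\<close>
  quasi-norm of the \<open>\<ell>\<^bsup>q1\<^esup>\<close> quasi-norm of \<open>|Q|\<^sup>\<beta>\<close> over the \<open>Q \<in> \<Gamma>\<close> containing \<open>x\<close>. At most one cube
  of each level contains \<open>x\<close>, so for \<open>\<beta> \<noteq> 0\<close> this family is part of a geometric sequence and \<open>q1\<close>
  may be replaced by \<open>p1\<close>; for \<open>q1 = p1\<close> integration gives exactly \<open>\<nu>\<close> with exponent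
  \<open>p1 \<beta> + 1\<close>. Conversely, single cubes force \<open>\<alpha> = p1 \<beta> + 1\<close>, and for \<open>\<alpha> = 1\<close> the set of all cubes of
  levels below \<open>N\<close> in the unit cube compares \<open>N\<^bsup>1/q1\<^esup>\<close> with \<open>N\<^bsup>1/p1\<^esup>\<close>, which forces \<open>q1 = p1\<close>.
\<close>

section \<open>Real powers on the extended half-line\<close>

lemma ennpowr_0 [simp]: "ennpowr 0 a = 0"
  by (simp add: ennpowr_def)

lemma ennpowr_ennreal: "0 \<le> x \<Longrightarrow> ennpowr (ennreal x) a = ennreal (x powr a)"
  by (simp add: ennpowr_def)

lemma ennpowr_mono: "0 \<le> a \<Longrightarrow> x \<le> y \<Longrightarrow> ennpowr x a \<le> ennpowr y a"
  by (cases x; cases y) (auto simp: ennpowr_def intro!: ennreal_leI powr_mono2 simp: top_unique split: if_splits)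

lemma ennpowr_ennpowr: "ennpowr (ennpowr x a) b = ennpowr x (a * b)"
  by (cases x) (auto simp: ennpowr_def powr_powr)

lemma ennpowr_1 [simp]: "ennpowr x 1 = x"
  by (cases x) (auto simp: ennpowr_def)

lemma ennpowr_mult:
  assumes "0 < c"
  shows "ennpowr (ennreal c * x) a = ennreal (c powr a) * ennpowr x a"
  using assms
  by (cases x) (auto simp: ennpowr_def ennreal_mult'[symmetric] powr_mult ennreal_mult_top)

section \<open>Unordered sums and their integrals\<close>

text \<open>Every family in \<open>ennreal\<close> is summable, so an enumeration of the index set
  turns the unordered sum into a series, to which monotone convergence applies.\<close>

lemma infsum_ennreal_eq_suminf:
  fixes f :: "'i \<Rightarrow> ennreal"
  assumes "countable I" "infinite I"
  shows "infsum f I = (\<Sum>n. f (from_nat_into I n))"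
proof -
  have "infsum f I = infsum (\<lambda>n. f (from_nat_into I n)) UNIV"
    using infsum_reindex_bij_betw[OF bij_betw_from_nat_into[OF assms], of f] by simp
  also have "\<dots> = (\<Sum>n. f (from_nat_into I n))"
  proof (rule sums_unique[OF has_sum_imp_sums[OF has_sum_infsum]])
    show "(\<lambda>n. f (from_nat_into I n)) summable_on UNIV"
      by (rule nonneg_summable_on_complete) simp
  qed
  finally show ?thesis .
qed

text \<open>Allows the integral over \<open>x\<close> to be taken cube by cube; the index set will
  be a set of dyadic cubes, hence countable.\<close>

lemma
  fixes f :: "'i \<Rightarrow> 'a \<Rightarrow> ennreal"
  assumes "countable I" "\<And>i. i \<in> I \<Longrightarrow> f i \<in> borel_measurable M"
  shows borel_measurable_infsum_ennreal: "(\<lambda>x. \<Sum>\<^sub>\<infinity>i\<in>I. f i x) \<in> borel_measurable M"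
    and nn_integral_infsum:
      "(\<integral>\<^sup>+x. (\<Sum>\<^sub>\<infinity>i\<in>I. f i x) \<partial>M) = (\<Sum>\<^sub>\<infinity>i\<in>I. \<integral>\<^sup>+x. f i x \<partial>M)"
proof -
  have "(\<lambda>x. \<Sum>\<^sub>\<infinity>i\<in>I. f i x) \<in> borel_measurable M \<and>
    (\<integral>\<^sup>+x. (\<Sum>\<^sub>\<infinity>i\<in>I. f i x) \<partial>M) = (\<Sum>\<^sub>\<infinity>i\<in>I. \<integral>\<^sup>+x. f i x \<partial>M)"
  proof (cases "finite I")
    case True
    then show ?thesis using assms(2) by (simp add: nn_integral_sum)
  next
    case False
    have "from_nat_into I n \<in> I" for n
      using False by (intro from_nat_into) auto
    then have "f (from_nat_into I n) \<in> borel_measurable M" for n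
      using assms(2) by blast
    then show ?thesis
      using False assms(1) by (simp add: infsum_ennreal_eq_suminf nn_integral_suminf)
  qed
  then show "(\<lambda>x. \<Sum>\<^sub>\<infinity>i\<in>I. f i x) \<in> borel_measurable M"
    "(\<integral>\<^sup>+x. (\<Sum>\<^sub>\<infinity>i\<in>I. f i x) \<partial>M) = (\<Sum>\<^sub>\<infinity>i\<in>I. \<integral>\<^sup>+x. f i x \<partial>M)"
    by blast+
qed

section \<open>Discrete quasi-norms of families\<close>

lemma ell_norm_ennreal:
  "0 < p \<Longrightarrow> ell_norm (ennreal p) I a = ennpowr (\<Sum>\<^sub>\<infinity>i\<in>I. ennreal (a i powr p)) (1 / p)"
  by (simp add: ell_norm_def)

lemma ennreal_pos_cases [consumes 1, case_names top real]:
  assumes "0 < (q::ennreal)"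
  obtains "q = \<infinity>" | r where "0 < r" "q = ennreal r"
  using assms by (cases q) auto

text \<open>Zero entries change neither the sum nor the supremum, as 0 is the least element of
  \<open>ennreal\<close>. This is how the family over all dyadic cubes becomes one over the levels
  at a fixed point.\<close>

lemma ell_norm_reindex:
  assumes "0 < r" and inj: "inj_on g J" and sub: "g ` J \<subseteq> I"
    and zero: "\<And>i. i \<in> I - g ` J \<Longrightarrow> a i = 0"
  shows "ell_norm r I a = ell_norm r J (\<lambda>j. a (g j))"
  using assms(1)
proof (cases rule: ennreal_pos_cases)
  case top
  have "(SUP i\<in>I. ennreal (a i)) \<le> (SUP j\<in>J. ennreal (a (g j)))"
  proof (rule SUP_least)
    fix i assume "i \<in> I"
    show "ennreal (a i) \<le> (SUP j\<in>J. ennreal (a (g j)))"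
      using zero[of i] \<open>i \<in> I\<close> by (cases "i \<in> g ` J") (auto intro: SUP_upper)
  qed
  moreover have "(SUP j\<in>J. ennreal (a (g j))) \<le> (SUP i\<in>I. ennreal (a i))"
    using sub by (intro SUP_least) (auto intro: SUP_upper)
  ultimately show ?thesis using top by (simp add: ell_norm_def)
next
  case (real p)
  have "(\<Sum>\<^sub>\<infinity>i\<in>I. ennreal (a i powr p)) = (\<Sum>\<^sub>\<infinity>i\<in>g ` J. ennreal (a i powr p))"
    using sub zero by (intro infsum_cong_neutral) auto
  also have "\<dots> = (\<Sum>\<^sub>\<infinity>j\<in>J. ennreal (a (g j) powr p))"
    using infsum_reindex[OF inj] by (simp add: o_def)
  finally show ?thesis using real by (simp add: ell_norm_ennreal)
qed

lemma ell_norm_empty [simp]: "0 < r \<Longrightarrow> ell_norm r {} a = 0"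
  by (simp add: ell_norm_def) (simp add: bot_ennreal)

lemma recip_top [simp]: "recip top = 0"
  by (simp add: recip_def)

lemma recip_ennreal: "0 < p \<Longrightarrow> recip (ennreal p) = 1 / p"
  by (simp add: recip_def ennreal_1[symmetric] divide_ennreal del: ennreal_1)

lemma ell_norm_singleton:
  assumes "0 < r" "0 \<le> a i"
  shows "ell_norm r {i} a = ennreal (a i)"
  using assms(1)
proof (cases rule: ennreal_pos_cases)
  case top
  then show ?thesis by (simp add: ell_norm_def)
next
  case (real p)
  then show ?thesis using assms by (simp add: ell_norm_ennreal ennpowr_ennreal powr_powr)
qed

lemma ell_norm_const:
  assumes "0 < r" "finite I" "I \<noteq> {}" "0 \<le> c"
  shows "ell_norm r I (\<lambda>_. c) = ennreal (c * real (card I) powr recip r)"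
  using assms(1)
proof (cases rule: ennreal_pos_cases)
  case top
  \<comment> \<open>Since \<open>0 powr 0 = 0\<close>, the factor \<open>card I powr 0\<close>
    equals 1 only for a nonzero cardinality.\<close>
  have "card I \<noteq> 0" using assms by simp
  then show ?thesis using top \<open>I \<noteq> {}\<close> by (simp add: ell_norm_def)
next
  case (real p)
  have "(\<Sum>i\<in>I. ennreal (c powr p)) = ennreal (real (card I) * c powr p)"
    by (simp add: ennreal_mult ennreal_of_nat_eq_real_of_nat)
  then show ?thesis using real assms
    by (simp add: ell_norm_ennreal recip_ennreal ennpowr_ennreal powr_mult powr_powr mult.commute)
qed

section \<open>Geometric families indexed by sets of integers\<close>

text \<open>Counted from the largest exponent, the others decrease by distinct multiples of
  \<open>\<bar>b\<bar>\<close>, so the full geometric series of ratio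
  \<open>2 powr (- \<bar>b\<bar>)\<close> dominates the sum. The bound depends neither on the size
  nor on the position of \<open>F\<close>.\<close>

lemma sum_geometric_le_Max:
  fixes b :: real
  assumes "b \<noteq> 0" "finite F" "F \<noteq> {}"
  shows "\<exists>m\<in>F. (\<Sum>j\<in>F. 2 powr (b * real_of_int j))
           \<le> 2 powr (b * real_of_int m) / (1 - 2 powr (- \<bar>b\<bar>))"
proof -
  define f where "f j = b * real_of_int j" for j :: int
  have "Max (f ` F) \<in> f ` F" using assms by (intro Max_in) auto
  then obtain m where m: "m \<in> F" "Max (f ` F) = f m" by blast
  have le: "f j \<le> f m" if "j \<in> F" for j
    using Max_ge[of "f ` F" "f j"] that m assms by simp
  define g where "g j = nat \<bar>m - j\<bar>" for j
  have eq: "f j = f m - \<bar>b\<bar> * real (g j)" if "j \<in> F" for j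
  proof -
    have "\<bar>b\<bar> * real (g j) = \<bar>b * (real_of_int m - real_of_int j)\<bar>"
      by (simp add: g_def abs_mult)
    also have "\<dots> = b * (real_of_int m - real_of_int j)"
      using le[OF that] by (simp add: f_def algebra_simps)
    finally show ?thesis by (simp add: f_def algebra_simps)
  qed
  \<comment> \<open>All of \<open>F\<close> lies on one side of \<open>m\<close>, so the distance to
    \<open>m\<close> determines the index.\<close>
  have inj: "inj_on g F"
  proof
    fix x y assume "x \<in> F" "y \<in> F" "g x = g y"
    then have "f x = f y" using eq by simp
    then show "x = y" using assms by (simp add: f_def)
  qed
  define t :: real where "t = 2 powr (- \<bar>b\<bar>)"
  have t: "0 < t" "t < 1"
    using assms by (auto simp: t_def powr_less_one)
  have "(\<Sum>j\<in>F. 2 powr f j) = (\<Sum>j\<in>F. 2 powr f m * t ^ g j)"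
  proof (rule sum.cong)
    fix j assume "j \<in> F"
    have "t ^ g j = 2 powr (- \<bar>b\<bar> * real (g j))"
      using t by (simp add: t_def powr_realpow[symmetric] powr_powr)
    then show "2 powr f j = 2 powr f m * t ^ g j"
      using eq[OF \<open>j \<in> F\<close>] by (simp add: powr_add[symmetric])
  qed simp
  also have "\<dots> = 2 powr f m * (\<Sum>n\<in>g ` F. t ^ n)"
    using inj by (simp add: sum_distrib_left sum.reindex)
  also have "\<dots> \<le> 2 powr f m * (\<Sum>n. t ^ n)"
    using t assms by (intro mult_left_mono sum_le_suminf summable_geometric) auto
  also have "\<dots> = 2 powr f m / (1 - t)"
    using t by (simp add: suminf_geometric)
  finally show ?thesis
    using m by (auto simp: f_def t_def)
qed

text \<open>The supremum serves as a common yardstick for all \<open>q\<close>. The constant must be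
  chosen before \<open>J\<close>, because \<open>J\<close> will later vary with the point and with
  the set of cubes.\<close>

lemma ell_norm_geometric_SUP:
  fixes b :: real
  assumes "b \<noteq> 0" "0 < q"
  shows "\<exists>C>0. \<forall>J :: int set.
    (SUP j\<in>J. ennreal (2 powr (b * real_of_int j)))
      \<le> ell_norm q J (\<lambda>j. 2 powr (b * real_of_int j)) \<and>
    ell_norm q J (\<lambda>j. 2 powr (b * real_of_int j))
      \<le> ennreal C * (SUP j\<in>J. ennreal (2 powr (b * real_of_int j)))"
  using assms(2)
proof (cases rule: ennreal_pos_cases)
  case top
  then show ?thesis by (intro exI[of _ 1]) (auto simp: ell_norm_def)
next
  case (real p)
  \<comment> \<open>The \<open>p\<close>-th powers form a geometric family with exponent
    \<open>b * p\<close>; \<open>C\<close> is its series constant, and the final constant is the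
    \<open>p\<close>-th root of \<open>C\<close>.\<close>
  define C where "C = 1 / (1 - 2 powr (- \<bar>b * p\<bar>))"
  have bp: "b * p \<noteq> 0" using assms real by simp
  then have "2 powr (- \<bar>b * p\<bar>) < (1::real)" by (intro powr_less_one) auto
  then have C: "C > 0" by (simp add: C_def)
  show ?thesis
  proof (intro exI conjI allI)
    show "C powr (1 / p) > 0" using C by simp
    fix J :: "int set"
    define M where "M = (SUP j\<in>J. ennreal (2 powr (b * real_of_int j)))"
    define S where "S = (\<Sum>\<^sub>\<infinity>j\<in>J. ennreal (2 powr (b * p * real_of_int j)))"
    have ell: "ell_norm q J (\<lambda>j. 2 powr (b * real_of_int j)) = ennpowr S (1 / p)"
      using real by (simp add: ell_norm_ennreal powr_powr S_def mult_ac)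
    have S_SUP: "S = (SUP F\<in>{F. finite F \<and> F \<subseteq> J}. \<Sum>j\<in>F. ennreal (2 powr (b * p * real_of_int j)))"
      unfolding S_def by (rule nonneg_infsum_complete) simp
    have root: "ennpowr (ennreal (2 powr (b * p * real_of_int j))) (1 / p)
        = ennreal (2 powr (b * real_of_int j))" for j
      using real by (simp add: ennpowr_ennreal powr_powr)
    show "M \<le> ell_norm q J (\<lambda>j. 2 powr (b * real_of_int j))"
      unfolding M_def ell
    proof (rule SUP_least)
      fix j assume "j \<in> J"
      have "ennreal (2 powr (b * p * real_of_int j))
          = (\<Sum>j\<in>{j}. ennreal (2 powr (b * p * real_of_int j)))" by simp
      also have "\<dots> \<le> S" unfolding S_SUP using \<open>j \<in> J\<close> by (intro SUP_upper) auto
      finally show "ennreal (2 powr (b * real_of_int j)) \<le> ennpowr S (1 / p)"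
        using real by (subst root[symmetric]) (intro ennpowr_mono, auto)
    qed
    \<comment> \<open>An infinite \<open>J\<close> need not contain a largest term, so the bound is
      proved for finite partial sums, whose supremum is \<open>S\<close>.\<close>
    have "S \<le> ennreal C * ennpowr M p"
      unfolding S_SUP
    proof (rule SUP_least, clarify)
      fix F assume F: "finite F" "F \<subseteq> J"
      show "(\<Sum>j\<in>F. ennreal (2 powr (b * p * real_of_int j))) \<le> ennreal C * ennpowr M p"
      proof (cases "F = {}")
        case False
        obtain m where m: "m \<in> F" "(\<Sum>j\<in>F. 2 powr (b * p * real_of_int j))
             \<le> 2 powr (b * p * real_of_int m) * C"
          using sum_geometric_le_Max[OF bp F(1) False] by (auto simp: C_def)
        have "ennreal (2 powr (b * p * real_of_int m)) = ennpowr (ennreal (2 powr (b * real_of_int m))) p"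
          by (simp add: ennpowr_ennreal powr_powr mult_ac)
        also have "\<dots> \<le> ennpowr M p"
          unfolding M_def using m F real by (intro ennpowr_mono SUP_upper) auto
        finally have "ennreal C * ennreal (2 powr (b * p * real_of_int m)) \<le> ennreal C * ennpowr M p"
          by (intro mult_left_mono) auto
        moreover have "(\<Sum>j\<in>F. ennreal (2 powr (b * p * real_of_int j)))
            \<le> ennreal C * ennreal (2 powr (b * p * real_of_int m))"
          using m C by (simp add: ennreal_mult[symmetric] ennreal_leI mult.commute)
        ultimately show ?thesis by (rule order_trans[rotated])
      qed simp
    qed
    then have "ennpowr S (1 / p) \<le> ennpowr (ennreal C * ennpowr M p) (1 / p)"
      using real by (intro ennpowr_mono) auto
    also have "\<dots> = ennreal (C powr (1 / p)) * M"
      using real C by (simp add: ennpowr_mult ennpowr_ennpowr)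
    finally show "ell_norm q J (\<lambda>j. 2 powr (b * real_of_int j)) \<le> ennreal (C powr (1 / p)) * M"
      unfolding ell .
  qed
qed

text \<open>
  A geometric family is dominated by its largest term, so all \<open>\<ell>\<^sup>q\<close> quasi-norms agree up to
  constants on it.
\<close>

lemma ell_norm_geometric_comparable:
  fixes b :: real
  assumes "b \<noteq> 0" "0 < q" "0 < q'"
  shows "\<exists>C>0. \<forall>J :: int set.
    ell_norm q J (\<lambda>j. 2 powr (b * real_of_int j))
      \<le> ennreal C * ell_norm q' J (\<lambda>j. 2 powr (b * real_of_int j))"
proof -
  obtain C where C: "C > 0" "\<And>J :: int set. ell_norm q J (\<lambda>j. 2 powr (b * real_of_int j))
      \<le> ennreal C * (SUP j\<in>J. ennreal (2 powr (b * real_of_int j)))"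
    using ell_norm_geometric_SUP[OF assms(1,2)] by blast
  have "(SUP j\<in>J. ennreal (2 powr (b * real_of_int j)))
      \<le> ell_norm q' J (\<lambda>j. 2 powr (b * real_of_int j))" for J :: "int set"
    using ell_norm_geometric_SUP[OF assms(1,3)] by blast
  then have "ell_norm q J (\<lambda>j. 2 powr (b * real_of_int j))
      \<le> ennreal C * ell_norm q' J (\<lambda>j. 2 powr (b * real_of_int j))" for J :: "int set"
    using C(2)[of J] by (meson mult_left_mono order_trans zero_le)
  then show ?thesis using C(1) by blast
qed

section \<open>The integral quasi-norm\<close>

lemma Lp_norm_mono:
  "0 < p \<Longrightarrow> (\<And>x. f x \<le> g x) \<Longrightarrow> Lp_norm p f \<le> Lp_norm p g"
  unfolding Lp_norm_def by (intro ennpowr_mono nn_integral_mono) auto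

lemma Lp_norm_cmult:
  assumes "0 < p" "0 < c" "(\<lambda>x. ennpowr (f x) p) \<in> borel_measurable lborel"
  shows "Lp_norm p (\<lambda>x. ennreal c * f x) = ennreal c * Lp_norm p f"
  using assms by (simp add: Lp_norm_def ennpowr_mult nn_integral_cmult powr_powr)

lemma Lp_norm_const_indicator:
  assumes "0 < p" "0 \<le> c" "A \<in> sets lborel" "emeasure lborel A = ennreal m" "0 \<le> m"
  shows "Lp_norm p (\<lambda>x. if x \<in> A then ennreal c else 0) = ennreal (c * m powr (1 / p))"
proof -
  have "(\<lambda>x. ennpowr (if x \<in> A then ennreal c else 0) p)
      = (\<lambda>x. ennreal (c powr p) * indicator A x)"
    using assms by (auto simp: ennpowr_ennreal indicator_def)
  then show ?thesis using assms
    by (simp add: Lp_norm_def nn_integral_cmult_indicator ennreal_mult[symmetric] ennpowr_ennreal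
        powr_mult powr_powr)
qed

section \<open>Geometry of dyadic cubes\<close>

text \<open>Scaling by \<open>2 powi j\<close> turns the cubes of level \<open>j\<close> into
  integer translates of the half-open unit cube. In particular, each point lies in exactly one cube
  of each level.\<close>

lemma mem_dyadic_cube_iff: "x \<in> dyadic_cube j k \<longleftrightarrow> (\<forall>i. \<lfloor>2 powi j * x $ i\<rfloor> = k $ i)"
proof
  assume "x \<in> dyadic_cube j k"
  then obtain y where y: "\<forall>i. 0 \<le> y $ i \<and> y $ i < 1"
    "x = 2 powi (- j) *\<^sub>R (y + (\<chi> i. of_int (k $ i)))"
    by (auto simp: dyadic_cube_def)
  show "\<forall>i. \<lfloor>2 powi j * x $ i\<rfloor> = k $ i"
    using y by (auto simp: power_int_minus floor_eq_iff mult.assoc[symmetric])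
next
  assume x: "\<forall>i. \<lfloor>2 powi j * x $ i\<rfloor> = k $ i"
  \<comment> \<open>The preimage of \<open>x\<close> in the unit cube: the fractional parts of the
    scaled coordinates.\<close>
  let ?y = "2 powi j *\<^sub>R x - (\<chi> i. of_int (k $ i))"
  have "\<forall>i. 0 \<le> ?y $ i \<and> ?y $ i < 1"
  proof
    fix i
    have "\<lfloor>2 powi j * x $ i\<rfloor> = k $ i" using x by simp
    then show "0 \<le> ?y $ i \<and> ?y $ i < 1"
      by (simp add: floor_eq_iff algebra_simps)
  qed
  moreover have "x = 2 powi (- j) *\<^sub>R (?y + (\<chi> i. of_int (k $ i)))"
    by (simp add: power_int_minus)
  ultimately show "x \<in> dyadic_cube j k"
    unfolding dyadic_cube_def by blast
qed

lemma emeasure_dyadic_cube: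
  fixes k :: "int ^ 'd"
  shows "dyadic_cube j k \<in> sets borel"
    and "emeasure lborel (dyadic_cube j k) = ennreal (2 powr (- (of_int j * real CARD('d))))"
proof -
  let ?Q = "dyadic_cube j k"
  let ?l = "(\<chi> i. 2 powi (- j) * of_int (k $ i)) :: real ^ 'd"
  let ?u = "(\<chi> i. 2 powi (- j) * (of_int (k $ i) + 1)) :: real ^ 'd"
  have Q: "?Q = {x. \<forall>i. of_int (k $ i) \<le> 2 powi j * x $ i \<and> 2 powi j * x $ i < of_int (k $ i) + 1}"
    by (auto simp: mem_dyadic_cube_iff floor_eq_iff)
  have "{x. \<forall>i. of_int (k $ i) \<le> 2 powi j * x $ i \<and> 2 powi j * x $ i < of_int (k $ i) + 1}
      \<in> sets (borel :: (real ^ 'd) measure)"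
    by measurable
  then show meas: "?Q \<in> sets borel" unfolding Q .
  have Q': "?Q = {x. \<forall>i. ?l $ i \<le> x $ i \<and> x $ i < ?u $ i}"
    unfolding Q by (simp add: power_int_minus field_simps)
  \<comment> \<open>The half-open cube is squeezed between the open and the closed box with the same
    corners, which have equal measure.\<close>
  have "box ?l ?u \<subseteq> ?Q" "?Q \<subseteq> cbox ?l ?u"
    unfolding Q' by (auto simp: mem_box_cart less_imp_le)
  then have "emeasure lborel (box ?l ?u) \<le> emeasure lborel ?Q"
    "emeasure lborel ?Q \<le> emeasure lborel (cbox ?l ?u)"
    using meas by (auto intro!: emeasure_mono)
  moreover have le: "?l \<bullet> b \<le> ?u \<bullet> b" if "b \<in> Basis" for b
    using that by (auto simp: Basis_vec_def inner_axis)
  moreover have "(\<Prod>b\<in>Basis. (?u - ?l) \<bullet> b) = (2 powi (- j)) ^ CARD('d)"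
  proof -
    have "(\<Prod>b\<in>Basis. (?u - ?l) \<bullet> b) = (\<Prod>b\<in>(Basis :: (real ^ 'd) set). 2 powi (- j))"
      by (intro prod.cong) (auto simp: Basis_vec_def inner_axis algebra_simps)
    then show ?thesis by simp
  qed
  moreover have "(2 powi (- j)) ^ CARD('d) = (2::real) powr (- (of_int j * real CARD('d)))"
  proof -
    have "(2::real) powi (- j) = 2 powr of_int (- j)"
      by (rule powr_real_of_int'[symmetric]) auto
    then show ?thesis by (simp only: powr_power) (simp add: mult.commute)
  qed
  ultimately show "emeasure lborel ?Q = ennreal (2 powr (- (of_int j * real CARD('d))))"
    using emeasure_lborel_box[OF le] emeasure_lborel_cbox[OF le] by (metis order_antisym)
qed

lemma vol_dyadic_cube:
  "vol (dyadic_cube j (k :: int ^ 'd)) = 2 powr (- (of_int j * real CARD('d)))"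
  by (simp add: measure_def emeasure_dyadic_cube)

lemma dyadic_cubes_borel: "Q \<in> dyadic_cubes \<Longrightarrow> Q \<in> sets borel"
  by (auto simp: dyadic_cubes_def emeasure_dyadic_cube)

lemma vol_pos: "Q \<in> dyadic_cubes \<Longrightarrow> vol Q > 0"
  by (auto simp: dyadic_cubes_def vol_dyadic_cube)

lemma emeasure_eq_vol: "Q \<in> dyadic_cubes \<Longrightarrow> emeasure lborel Q = ennreal (vol Q)"
  by (auto simp: dyadic_cubes_def vol_dyadic_cube emeasure_dyadic_cube)

section \<open>The cubes through a given point\<close>

definition cube_at :: "int \<Rightarrow> real ^ 'd \<Rightarrow> (real ^ 'd) set" where
  "cube_at j x = dyadic_cube j (\<chi> i. \<lfloor>2 powi j * x $ i\<rfloor>)"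

text \<open>The cubes of \<open>\<Gamma>\<close> through \<open>x\<close>, recorded by their levels.
  On these integers a power of the volume becomes a geometric family.\<close>

definition levels :: "(real ^ 'd) set set \<Rightarrow> real ^ 'd \<Rightarrow> int set" where
  "levels \<Gamma> x = {j. cube_at j x \<in> \<Gamma>}"

lemma cube_at_dyadic [simp]: "cube_at j x \<in> dyadic_cubes"
  by (auto simp: cube_at_def dyadic_cubes_def)

lemma mem_cube_at [simp]: "x \<in> cube_at j x"
  by (simp add: cube_at_def mem_dyadic_cube_iff)

lemma cube_at_eq: "x \<in> dyadic_cube j k \<Longrightarrow> cube_at j x = dyadic_cube j k"
  by (auto simp: cube_at_def mem_dyadic_cube_iff intro!: arg_cong[of _ _ "dyadic_cube j"] vec_eq_iff[THEN iffD2])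

lemma vol_cube_at: "vol (cube_at j (x :: real ^ 'd)) = 2 powr (- (of_int j * real CARD('d)))"
  by (simp add: cube_at_def vol_dyadic_cube)

text \<open>The volume already determines the level.\<close>

lemma dyadic_cube_level_eq:
  assumes "dyadic_cube j (k :: int ^ 'd) = dyadic_cube j' k'"
  shows "j = j'"
proof -
  have "(2::real) powr (- (of_int j * real CARD('d))) = 2 powr (- (of_int j' * real CARD('d)))"
    using assms by (metis vol_dyadic_cube)
  from arg_cong[OF this, of "log 2"] show ?thesis by simp
qed

lemma inj_cube_at: "inj_on (\<lambda>j. cube_at j x) J"
  by (auto simp: inj_on_def cube_at_def dest: dyadic_cube_level_eq)

lemma cube_at_levels:
  assumes "\<Gamma> \<subseteq> dyadic_cubes"
  shows "(\<lambda>j. cube_at j x) ` levels \<Gamma> x = {Q \<in> \<Gamma>. x \<in> Q}"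
proof (intro equalityI subsetI)
  fix Q assume "Q \<in> {Q \<in> \<Gamma>. x \<in> Q}"
  then have Q: "Q \<in> \<Gamma>" "x \<in> Q" by auto
  then obtain j k where "Q = dyadic_cube j k"
    using assms by (auto simp: dyadic_cubes_def)
  then have "cube_at j x = Q" using Q cube_at_eq by blast
  then show "Q \<in> (\<lambda>j. cube_at j x) ` levels \<Gamma> x"
    using Q by (auto simp: levels_def)
qed (auto simp: levels_def)

lemma countable_dyadic_cubes: "countable (dyadic_cubes :: (real ^ 'd) set set)"
proof -
  \<comment> \<open>The index type, integers paired with functions from the finite type
    \<open>'d\<close> to the integers, is countable.\<close>
  have "dyadic_cubes \<subseteq> range (\<lambda>(j, f :: 'd \<Rightarrow> int). dyadic_cube j (vec_lambda f))"
  proof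
    fix Q :: "(real ^ 'd) set" assume "Q \<in> dyadic_cubes"
    then obtain j k where "Q = dyadic_cube j k" by (auto simp: dyadic_cubes_def)
    then have "Q = (\<lambda>(j, f). dyadic_cube j (vec_lambda f)) (j, vec_nth k)" by simp
    then show "Q \<in> range (\<lambda>(j, f :: 'd \<Rightarrow> int). dyadic_cube j (vec_lambda f))" by (rule range_eqI)
  qed
  then show ?thesis by (rule countable_subset) simp
qed

text \<open>Trades an index set depending on \<open>x\<close> for the fixed set
  \<open>\<Gamma>\<close> with indicators, a form that can be integrated termwise.\<close>

lemma infsum_levels:
  fixes h :: "(real ^ 'd) set \<Rightarrow> ennreal"
  assumes "\<Gamma> \<subseteq> dyadic_cubes"
  shows "(\<Sum>\<^sub>\<infinity>j\<in>levels \<Gamma> x. h (cube_at j x)) = (\<Sum>\<^sub>\<infinity>Q\<in>\<Gamma>. h Q * indicator Q x)"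
proof -
  have "(\<Sum>\<^sub>\<infinity>j\<in>levels \<Gamma> x. h (cube_at j x)) = infsum h {Q \<in> \<Gamma>. x \<in> Q}"
    unfolding cube_at_levels[OF assms, symmetric]
    by (subst infsum_reindex[OF inj_cube_at]) (simp add: o_def)
  also have "\<dots> = (\<Sum>\<^sub>\<infinity>Q\<in>\<Gamma>. h Q * indicator Q x)"
    by (intro infsum_cong_neutral) auto
  finally show ?thesis .
qed

section \<open>Quasi-norms of sequences whose entries are powers of the volume\<close>

text \<open>The exponent \<open>recip r\<close> of the weight cancels against the normalization in
  \<open>chi\<close>, so \<open>r\<close> survives only as the index of the inner quasi-norm. The
  volume at level \<open>j\<close> then gives the geometric family.\<close>

lemma fnorm_eq_Lp_norm_levels:
  fixes \<Gamma> :: "(real ^ 'd) set set"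
  assumes "\<Gamma> \<subseteq> dyadic_cubes" "0 < r"
    and c: "\<And>Q. Q \<in> \<Gamma> \<Longrightarrow> c Q = complex_of_real (vol Q powr \<gamma>)"
  shows "fnorm s p r (formal_sum \<Gamma> c) =
    Lp_norm p (\<lambda>x. ell_norm r (levels \<Gamma> x)
      (\<lambda>j. 2 powr (- (real CARD('d) * (\<gamma> - s / real CARD('d) - 1 / 2)) * of_int j)))"
  unfolding fnorm_def
proof (rule arg_cong[of _ _ "Lp_norm p"], rule ext)
  fix x :: "real ^ 'd"
  let ?a = "\<lambda>Q. vol Q powr (- s / real CARD('d) + recip r - 1 / 2)
    * norm (formal_sum \<Gamma> c Q) * chi r Q x"
  let ?b = "\<lambda>j. 2 powr (- (real CARD('d) * (\<gamma> - s / real CARD('d) - 1 / 2)) * of_int j)"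
  have "ell_norm r dyadic_cubes ?a = ell_norm r (levels \<Gamma> x) (\<lambda>j. ?a (cube_at j x))"
  proof (rule ell_norm_reindex)
    show "?a Q = 0" if "Q \<in> dyadic_cubes - (\<lambda>j. cube_at j x) ` levels \<Gamma> x" for Q
      using that unfolding cube_at_levels[OF assms(1)] by (auto simp: formal_sum_def chi_def)
  qed (use assms inj_cube_at in auto)
  also have "\<dots> = ell_norm r (levels \<Gamma> x) ?b"
  proof -
    have "?a (cube_at j x) = ?b j" if "j \<in> levels \<Gamma> x" for j
    proof -
      let ?Q = "cube_at j x"
      have "?a ?Q = vol ?Q powr (- s / real CARD('d) + recip r - 1 / 2) * vol ?Q powr \<gamma> * vol ?Q powr (- recip r)"
        using that c[of ?Q] by (simp add: formal_sum_def chi_def levels_def norm_of_real)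
      also have "\<dots> = vol ?Q powr (\<gamma> - s / real CARD('d) - 1 / 2)"
        by (simp add: powr_add[symmetric] algebra_simps)
      finally show ?thesis by (simp add: vol_cube_at powr_powr mult_ac)
    qed
    then show ?thesis
      by (auto simp: ell_norm_def cong: infsum_cong SUP_cong)
  qed
  finally show "ell_norm r dyadic_cubes ?a = ell_norm r (levels \<Gamma> x) ?b" .
qed

text \<open>A single cube makes the inner quasi-norm constant on \<open>Q\<close> and zero
  elsewhere, whatever \<open>r\<close> is. This yields both the normalizing factors and the one-cube
  test sets.\<close>

lemma fnorm_single:
  fixes Q :: "(real ^ 'd) set"
  assumes "Q \<in> dyadic_cubes" "0 < p" "0 < r" "c Q = complex_of_real (vol Q powr \<gamma>)"
  shows "fnorm s p r (formal_sum {Q} c) = ennreal (vol Q powr (\<gamma> - s / real CARD('d) - 1 / 2 + 1 / p))"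
proof -
  obtain j k where Q: "Q = dyadic_cube j k"
    using assms by (auto simp: dyadic_cubes_def)
  have lev: "levels {Q} x = (if x \<in> Q then {j} else {})" for x
    using cube_at_eq[of x j k] mem_cube_at[of x]
    by (auto simp: levels_def Q) (auto simp: cube_at_def dest: dyadic_cube_level_eq)
  let ?e = "\<gamma> - s / real CARD('d) - 1 / 2"
  have "fnorm s p r (formal_sum {Q} c)
      = Lp_norm p (\<lambda>x. ell_norm r (levels {Q} x) (\<lambda>j. 2 powr (- (real CARD('d) * ?e) * of_int j)))"
    by (rule fnorm_eq_Lp_norm_levels) (use assms in auto)
  also have "\<dots> = Lp_norm p (\<lambda>x. if x \<in> Q then ennreal (vol Q powr ?e) else 0)"
    using assms by (intro arg_cong[of _ _ "Lp_norm p"] ext)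
      (simp add: lev[unfolded Q] Q ell_norm_singleton vol_dyadic_cube powr_powr mult_ac)
  also have "\<dots> = ennreal (vol Q powr ?e * vol Q powr (1 / p))"
    using assms by (intro Lp_norm_const_indicator) (auto simp: dyadic_cubes_borel emeasure_eq_vol)
  finally show ?thesis by (simp add: powr_add)
qed

lemma fnorm_unit_seq:
  fixes Q :: "(real ^ 'd) set"
  assumes "Q \<in> dyadic_cubes" "0 < p" "0 < r"
  shows "fnorm s p r (unit_seq Q) = ennreal (vol Q powr (1 / p - s / real CARD('d) - 1 / 2))"
proof -
  \<comment> \<open>The coefficient 1 is the power of the positive number \<open>vol Q\<close> with
    exponent 0.\<close>
  have "unit_seq Q = formal_sum {Q} (\<lambda>_. 1)"
    by (auto simp: unit_seq_def formal_sum_def)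
  then show ?thesis
    using fnorm_single[of Q p r "\<lambda>_. 1" 0 s] assms vol_pos[of Q] by (simp add: algebra_simps)
qed

text \<open>When the inner index equals \<open>p\<close>, the outer power undoes the inner root.
  What remains is a sum of multiples of indicators, and integration multiplies each term by the
  volume of its cube, hence the \<open>+ 1\<close> in the exponent.\<close>

lemma
  fixes \<Gamma> :: "(real ^ 'd) set set" and p \<beta> :: real
  assumes sub: "\<Gamma> \<subseteq> dyadic_cubes" and p: "0 < p"
  defines "f \<equiv> \<lambda>x. ell_norm (ennreal p) (levels \<Gamma> x)
    (\<lambda>j. 2 powr (- (real CARD('d) * \<beta>) * of_int j))"
  shows measurable_ell_norm_levels: "(\<lambda>x. ennpowr (f x) p) \<in> borel_measurable lborel"
    and Lp_norm_ell_norm_levels: "Lp_norm p f = ennpowr (nu (p * \<beta> + 1) \<Gamma>) (1 / p)"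
proof -
  have eq: "ennpowr (f x) p = (\<Sum>\<^sub>\<infinity>Q\<in>\<Gamma>. ennreal (vol Q powr (p * \<beta>)) * indicator Q x)" for x
  proof -
    have "ennpowr (f x) p
        = (\<Sum>\<^sub>\<infinity>j\<in>levels \<Gamma> x. ennreal ((2 powr (- (real CARD('d) * \<beta>) * of_int j)) powr p))"
      using p by (simp add: f_def ell_norm_ennreal ennpowr_ennpowr)
    also have "\<dots> = (\<Sum>\<^sub>\<infinity>j\<in>levels \<Gamma> x. ennreal (vol (cube_at j x) powr (p * \<beta>)))"
      by (simp add: vol_cube_at powr_powr mult_ac)
    finally show ?thesis
      using infsum_levels[OF sub, of "\<lambda>Q. ennreal (vol Q powr (p * \<beta>))"] by simp
  qed
  have count: "countable \<Gamma>"
    using sub countable_dyadic_cubes countable_subset by blast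
  have meas: "(\<lambda>x. ennreal (vol Q powr (p * \<beta>)) * indicator Q x) \<in> borel_measurable lborel"
    if "Q \<in> \<Gamma>" for Q
  proof -
    have [measurable]: "Q \<in> sets borel" using that sub dyadic_cubes_borel by blast
    show ?thesis by measurable
  qed
  show "(\<lambda>x. ennpowr (f x) p) \<in> borel_measurable lborel"
    unfolding eq by (rule borel_measurable_infsum_ennreal[OF count meas])
  have "(\<integral>\<^sup>+x. ennpowr (f x) p \<partial>lborel)
      = (\<Sum>\<^sub>\<infinity>Q\<in>\<Gamma>. \<integral>\<^sup>+x. ennreal (vol Q powr (p * \<beta>)) * indicator Q x \<partial>lborel)"
    unfolding eq by (rule nn_integral_infsum[OF count meas])
  also have "\<dots> = nu (p * \<beta> + 1) \<Gamma>"
    unfolding nu_def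
  proof (rule infsum_cong)
    fix Q assume "Q \<in> \<Gamma>"
    then have Q: "Q \<in> dyadic_cubes" using sub by auto
    show "(\<integral>\<^sup>+x. ennreal (vol Q powr (p * \<beta>)) * indicator Q x \<partial>lborel) = ennreal (vol Q powr (p * \<beta> + 1))"
      using vol_pos[OF Q]
      by (simp add: nn_integral_cmult_indicator dyadic_cubes_borel[OF Q] emeasure_eq_vol[OF Q] powr_add ennreal_mult')
  qed
  finally show "Lp_norm p f = ennpowr (nu (p * \<beta> + 1) \<Gamma>) (1 / p)"
    by (simp add: Lp_norm_def)
qed

section \<open>Test sets of many generations in the unit cube\<close>

text \<open>The first \<open>N\<close> generations of dyadic subcubes of the half-open unit cube,
  with side lengths from 1 down to \<open>2 powi (1 - N)\<close>.\<close>

definition unit_cube_tower :: "nat \<Rightarrow> (real ^ 'd) set set" where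
  "unit_cube_tower N = {dyadic_cube j k | j k. 0 \<le> j \<and> j < int N \<and> (\<forall>i. 0 \<le> k $ i \<and> k $ i < 2 ^ nat j)}"

lemma unit_cube_tower_subset: "unit_cube_tower N \<subseteq> dyadic_cubes"
  by (auto simp: unit_cube_tower_def dyadic_cubes_def)

lemma dyadic_cube_eq_iff: "dyadic_cube j (k :: int ^ 'd) = dyadic_cube j' k' \<longleftrightarrow> j = j' \<and> k = k'"
proof
  assume eq: "dyadic_cube j k = dyadic_cube j' k'"
  have "dyadic_cube j k \<noteq> {}"
    using emeasure_dyadic_cube(2)[of j k] by auto
  then obtain x where x: "x \<in> dyadic_cube j k" by blast
  then have "x \<in> dyadic_cube j' k'" using eq by simp
  then show "j = j' \<and> k = k'"
    using x dyadic_cube_level_eq[OF eq] by (simp add: mem_dyadic_cube_iff vec_eq_iff)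
qed simp

text \<open>At each nonnegative level the bounds on the floors say just that the coordinates lie
  between 0 and 1, so every point of the unit cube is covered once per generation.\<close>

lemma levels_unit_cube_tower:
  fixes x :: "real ^ 'd"
  shows "levels (unit_cube_tower N) x = (if x \<in> dyadic_cube 0 0 then {0..<int N} else {})"
proof -
  have "(0 \<le> \<lfloor>2 powi j * x $ i\<rfloor> \<and> \<lfloor>2 powi j * x $ i\<rfloor> < 2 ^ nat j) \<longleftrightarrow> \<lfloor>x $ i\<rfloor> = 0"
    if "0 \<le> j" for i j
  proof -
    have p: "(2::real) powi j = 2 ^ nat j" using that by (simp add: power_int_def)
    have "\<lfloor>2 powi j * x $ i\<rfloor> < 2 ^ nat j \<longleftrightarrow> 2 ^ nat j * x $ i < 2 ^ nat j"
      unfolding p by (simp add: floor_less_iff)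
    also have "\<dots> \<longleftrightarrow> x $ i < 1" by simp
    finally show ?thesis
      unfolding p using mult_le_cancel_left_pos[of "2 ^ nat j" 0 "x $ i"] by (auto simp: floor_eq_iff)
  qed
  then show ?thesis
    by (auto simp: levels_def unit_cube_tower_def cube_at_def dyadic_cube_eq_iff mem_dyadic_cube_iff)
qed

text \<open>The inner quasi-norm is constant on a set of measure 1, so the result does not depend on
  \<open>p\<close> and exposes the index \<open>r\<close>.\<close>

lemma Lp_norm_unit_cube_tower:
  assumes "0 < p" "0 < r" "0 < N"
  shows "Lp_norm p (\<lambda>x :: real ^ 'd. ell_norm r (levels (unit_cube_tower N) x) (\<lambda>_. 1))
    = ennreal (real N powr recip r)"
proof -
  let ?Q = "dyadic_cube 0 0 :: (real ^ 'd) set"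
  have "Lp_norm p (\<lambda>x :: real ^ 'd. ell_norm r (levels (unit_cube_tower N) x) (\<lambda>_. 1))
      = Lp_norm p (\<lambda>x. if x \<in> ?Q then ennreal (real N powr recip r) else 0)"
    using assms by (intro arg_cong[of _ _ "Lp_norm p"] ext) (simp add: levels_unit_cube_tower ell_norm_const)
  also have "\<dots> = ennreal (real N powr recip r * 1 powr (1 / p))"
    using assms by (intro Lp_norm_const_indicator) (auto simp: emeasure_dyadic_cube)
  finally show ?thesis by simp
qed

section \<open>Comparing growth exponents\<close>

text \<open>Large positive \<open>j\<close> exclude \<open>t > 0\<close> and large negative
  \<open>j\<close> exclude \<open>t < 0\<close>.\<close>

lemma exponent_eq_0_if_powr_bounded:
  fixes t K :: real
  assumes "\<And>j :: int. 2 powr (of_int j * t) \<le> K"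
  shows "t = 0"
proof (rule ccontr)
  assume "t \<noteq> 0"
  have K: "K > 0" using assms[of 0] by simp
  have "\<exists>j :: int. log 2 K < of_int j * t"
  proof (cases "t > 0")
    case True
    obtain j :: int where "log 2 K / t < of_int j" using ex_less_of_int by blast
    then show ?thesis using True by (auto simp: pos_divide_less_eq)
  next
    case False
    obtain j :: int where "of_int j < log 2 K / t" using ex_of_int_less by blast
    then show ?thesis using False \<open>t \<noteq> 0\<close> by (auto simp: neg_less_divide_eq)
  qed
  then obtain j :: int where "log 2 K < of_int j * t" by blast
  then have "K < 2 powr (of_int j * t)"
    using K by (simp add: log_less_iff)
  then show False using assms[of j] by simp
qed

lemma powr_quotient_bounded_imp_eq:
  fixes a b C :: real
  assumes "0 < C" and le: "\<And>j :: int. 2 powr (of_int j * a) \<le> C * 2 powr (of_int j * b)"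
  shows "a = b"
proof -
  have "2 powr (of_int j * (a - b)) \<le> C" for j :: int
    using le[of j] by (simp add: right_diff_distrib powr_diff pos_divide_le_eq)
  then show ?thesis using exponent_eq_0_if_powr_bounded[of "a - b" C] by simp
qed

theorem theorem2p10p2:
  fixes s1 s2 p1 p2 \<alpha> :: real and q1 q2 :: ennreal
  assumes "0 < p1" and "0 < p2" and "0 < q1" and "0 < q2"
  shows "(\<exists>C::real. C > 0 \<and> (\<forall>\<Gamma> :: (real ^ 'd) set set.
             \<Gamma> \<subseteq> dyadic_cubes \<longrightarrow> nu \<alpha> \<Gamma> < \<infinity> \<longrightarrow>
               ennreal (inverse C) * ennpowr (nu \<alpha> \<Gamma>) (1 / p1)
                 \<le> fnorm s1 p1 q1 (formal_sum \<Gamma>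
                     (\<lambda>Q. complex_of_real (1 / enn2real (fnorm s2 p2 q2 (unit_seq Q)))))
             \<and> fnorm s1 p1 q1 (formal_sum \<Gamma>
                     (\<lambda>Q. complex_of_real (1 / enn2real (fnorm s2 p2 q2 (unit_seq Q)))))
                 \<le> ennreal C * ennpowr (nu \<alpha> \<Gamma>) (1 / p1)))
         \<longleftrightarrow>
         (\<alpha> \<noteq> 1 \<and> \<alpha> = p1 * ((s2 - s1) / real CARD('d) - 1 / p2) + 1) \<or>
         (\<alpha> = 1 \<and> (s2 - s1) / real CARD('d) = 1 / p2 \<and> ennreal p1 = q1)"
proof -
  define d where "d = real CARD('d)"
  define \<beta> where "\<beta> = (s2 - s1) / d - 1 / p2"
  define c :: "(real ^ 'd) set \<Rightarrow> complex"
    where "c = (\<lambda>Q. complex_of_real (1 / enn2real (fnorm s2 p2 q2 (unit_seq Q))))"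
  define F where "F \<Gamma> = fnorm s1 p1 q1 (formal_sum \<Gamma> c)" for \<Gamma>
  define f where "f q \<Gamma> x = ell_norm q (levels \<Gamma> x) (\<lambda>j. 2 powr (- (d * \<beta>) * of_int j))"
    for q :: ennreal and \<Gamma> :: "(real ^ 'd) set set" and x
  \<comment> \<open>The normalized coefficient of a cube is its volume to the power
    \<open>\<gamma>\<close>; the weight of the first space then lowers this exponent to
    \<open>\<beta>\<close>.\<close>
  define \<gamma> where "\<gamma> = s2 / d + 1 / 2 - 1 / p2"
  have d: "d > 0" by (simp add: d_def)
  have \<gamma>: "\<gamma> - s1 / d - 1 / 2 = \<beta>"
    by (simp add: \<gamma>_def \<beta>_def diff_divide_distrib)
  have c_eq: "c Q = complex_of_real (vol Q powr \<gamma>)" if "Q \<in> dyadic_cubes" for Q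
  proof -
    have "vol Q powr (1 / p2 - s2 / d - 1 / 2) = inverse (vol Q powr \<gamma>)"
      by (simp add: \<gamma>_def powr_minus[symmetric] algebra_simps)
    then show ?thesis
      using that assms by (simp add: c_def fnorm_unit_seq d_def inverse_eq_divide)
  qed
  have F_eq: "F \<Gamma> = Lp_norm p1 (f q1 \<Gamma>)" if "\<Gamma> \<subseteq> dyadic_cubes" for \<Gamma>
  proof -
    have "F \<Gamma> = Lp_norm p1 (\<lambda>x. ell_norm q1 (levels \<Gamma> x)
        (\<lambda>j. 2 powr (- (real CARD('d) * (\<gamma> - s1 / real CARD('d) - 1 / 2)) * of_int j)))"
      unfolding F_def using that assms(3) c_eq by (intro fnorm_eq_Lp_norm_levels) auto
    then show ?thesis by (simp only: d_def[symmetric] \<gamma> f_def[abs_def])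
  qed
  have F_single: "F {Q} = ennreal (vol Q powr (\<beta> + 1 / p1))" if "Q \<in> dyadic_cubes" for Q
    unfolding F_def using fnorm_single[where c = c and \<gamma> = \<gamma> and s = s1, OF that assms(1,3) c_eq[OF that]]
    by (simp only: d_def[symmetric] \<gamma>)
  have nu_single: "ennpowr (nu a {Q}) (1 / p1) = ennreal (vol Q powr (a / p1))"
    for a and Q :: "(real ^ 'd) set"
    by (simp add: nu_def ennpowr_ennreal powr_powr)
  have Lp: "Lp_norm p1 (f (ennreal p1) \<Gamma>) = ennpowr (nu (p1 * \<beta> + 1) \<Gamma>) (1 / p1)"
    and meas: "(\<lambda>x. ennpowr (f (ennreal p1) \<Gamma> x) p1) \<in> borel_measurable lborel"
    if "\<Gamma> \<subseteq> dyadic_cubes" for \<Gamma>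
    using Lp_norm_ell_norm_levels[OF that assms(1), of \<beta>]
      measurable_ell_norm_levels[OF that assms(1), of \<beta>]
    by (simp_all only: d_def[symmetric] f_def[abs_def])
  define P where "P C \<longleftrightarrow> C > 0 \<and> (\<forall>\<Gamma> :: (real ^ 'd) set set.
      \<Gamma> \<subseteq> dyadic_cubes \<longrightarrow> nu \<alpha> \<Gamma> < \<infinity> \<longrightarrow>
        ennreal (inverse C) * ennpowr (nu \<alpha> \<Gamma>) (1 / p1) \<le> F \<Gamma>
        \<and> F \<Gamma> \<le> ennreal C * ennpowr (nu \<alpha> \<Gamma>) (1 / p1))" for C :: real
  have "(\<exists>C. P C) \<longleftrightarrow> (\<alpha> \<noteq> 1 \<and> \<alpha> = p1 * \<beta> + 1) \<or> (\<alpha> = 1 \<and> \<beta> = 0 \<and> ennreal p1 = q1)"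
    (is "_ \<longleftrightarrow> ?R")
  proof
    assume ?R
    \<comment> \<open>In case (ii) \<open>\<beta> = 0\<close> gives the formula for
      \<open>\<alpha>\<close> as well; in case (i) \<open>\<alpha> \<noteq> 1\<close> forces
      \<open>\<beta> \<noteq> 0\<close>.\<close>
    then have \<alpha>: "\<alpha> = p1 * \<beta> + 1" and cases: "\<beta> \<noteq> 0 \<or> ennreal p1 = q1" by auto
    show "\<exists>C. P C"
    proof (cases "ennreal p1 = q1")
      case True
      then have "P 1" using F_eq Lp \<alpha> by (simp add: P_def)
      then show ?thesis by blast
    next
      case False
      then have b: "- (d * \<beta>) \<noteq> 0" using cases d by simp
      have p1: "0 < ennreal p1" using assms by simp
      \<comment> \<open>The comparison is uniform over all sets of integers, so one constant serves
        every \<open>\<Gamma>\<close> and every \<open>x\<close>.\<close>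
      obtain A where A: "A > 0" "\<And>\<Gamma> x. f q1 \<Gamma> x \<le> ennreal A * f (ennreal p1) \<Gamma> x"
        using ell_norm_geometric_comparable[OF b assms(3) p1] unfolding f_def by blast
      obtain B where B: "B > 0" "\<And>\<Gamma> x. f (ennreal p1) \<Gamma> x \<le> ennreal B * f q1 \<Gamma> x"
        using ell_norm_geometric_comparable[OF b p1 assms(3)] unfolding f_def by blast
      \<comment> \<open>The constant is moved next to \<open>f (ennreal p1)\<close>, whose
        \<open>p1\<close>-th power is known to be measurable, so that it can be pulled out of the
        integral.\<close>
      have B': "ennreal (inverse B) * f (ennreal p1) \<Gamma> x \<le> f q1 \<Gamma> x" for \<Gamma> x
      proof -
        have "ennreal (inverse B) * f (ennreal p1) \<Gamma> x \<le> ennreal (inverse B) * (ennreal B * f q1 \<Gamma> x)"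
          using B by (intro mult_left_mono) auto
        also have "\<dots> = f q1 \<Gamma> x"
          using B(1) by (simp add: mult.assoc[symmetric] ennreal_mult[symmetric])
        finally show ?thesis .
      qed
      have "P (max A B)"
        unfolding P_def
      proof (intro conjI allI impI)
        show "max A B > 0" using A by simp
        fix \<Gamma> :: "(real ^ 'd) set set" assume sub: "\<Gamma> \<subseteq> dyadic_cubes"
        let ?N = "ennpowr (nu \<alpha> \<Gamma>) (1 / p1)"
        have "ennreal (inverse (max A B)) * ?N \<le> ennreal (inverse B) * ?N"
          using B(1) by (intro mult_right_mono ennreal_leI le_imp_inverse_le) auto
        also have "\<dots> = Lp_norm p1 (\<lambda>x. ennreal (inverse B) * f (ennreal p1) \<Gamma> x)"
          using Lp_norm_cmult[OF assms(1) _ meas[OF sub], of "inverse B"] B(1) Lp[OF sub] \<alpha> by simp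
        also have "\<dots> \<le> F \<Gamma>"
          unfolding F_eq[OF sub] by (intro Lp_norm_mono assms(1) B')
        finally show "ennreal (inverse (max A B)) * ?N \<le> F \<Gamma>" .
        have "F \<Gamma> \<le> Lp_norm p1 (\<lambda>x. ennreal A * f (ennreal p1) \<Gamma> x)"
          unfolding F_eq[OF sub] by (intro Lp_norm_mono assms(1) A(2))
        also have "\<dots> = ennreal A * ?N"
          using Lp_norm_cmult[OF assms(1) A(1) meas[OF sub]] Lp[OF sub] \<alpha> by simp
        also have "\<dots> \<le> ennreal (max A B) * ?N"
          by (intro mult_right_mono ennreal_leI) auto
        finally show "F \<Gamma> \<le> ennreal (max A B) * ?N" .
      qed
      then show ?thesis by blast
    qed
  next
    assume "\<exists>C. P C"
    then obtain C where C: "C > 0"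
      and upper: "\<And>\<Gamma>. \<Gamma> \<subseteq> dyadic_cubes \<Longrightarrow> nu \<alpha> \<Gamma> < \<infinity> \<Longrightarrow>
        F \<Gamma> \<le> ennreal C * ennpowr (nu \<alpha> \<Gamma>) (1 / p1)"
      and lower: "\<And>\<Gamma>. \<Gamma> \<subseteq> dyadic_cubes \<Longrightarrow> nu \<alpha> \<Gamma> < \<infinity> \<Longrightarrow>
        ennreal (inverse C) * ennpowr (nu \<alpha> \<Gamma>) (1 / p1) \<le> F \<Gamma>"
      unfolding P_def by blast
    have \<alpha>: "\<alpha> = p1 * \<beta> + 1"
    proof -
      \<comment> \<open>The upper estimate on single cubes suffices, because \<open>j\<close> takes
        both signs: small and large cubes bound the exponent from opposite sides.\<close>
      have "2 powr (of_int j * - (d * (\<beta> + 1 / p1))) \<le> C * 2 powr (of_int j * - (d * (\<alpha> / p1)))"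
        for j :: int
      proof -
        let ?Q = "dyadic_cube j 0 :: (real ^ 'd) set"
        have Q: "?Q \<in> dyadic_cubes" by (auto simp: dyadic_cubes_def)
        have "ennreal (vol ?Q powr (\<beta> + 1 / p1)) \<le> ennreal (C * vol ?Q powr (\<alpha> / p1))"
          using upper[of "{?Q}"] Q C by (simp add: F_single nu_single ennreal_mult) (simp add: nu_def)
        then have "vol ?Q powr (\<beta> + 1 / p1) \<le> C * vol ?Q powr (\<alpha> / p1)"
          using C by (subst (asm) ennreal_le_iff) auto
        then show ?thesis
          by (simp add: vol_dyadic_cube powr_powr d_def mult_ac)
      qed
      then have "- (d * (\<beta> + 1 / p1)) = - (d * (\<alpha> / p1))"
        by (rule powr_quotient_bounded_imp_eq[OF C])
      then have "d * (\<beta> + 1 / p1) = d * (\<alpha> / p1)"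
        by (rule neg_equal_iff_equal[THEN iffD1])
      then have "\<beta> + 1 / p1 = \<alpha> / p1"
        unfolding mult_cancel_left using d by simp
      then show ?thesis using assms(1) by (simp add: field_simps)
    qed
    show ?R
    proof (cases "\<alpha> = 1")
      case True
      then have \<beta>: "\<beta> = 0" using \<alpha> assms(1) by simp
      \<comment> \<open>The cubes are not counted: the identity for equal indices expresses
        \<open>nu\<close> through the tower quasi-norm with \<open>r = p1\<close>.\<close>
      have nu: "ennpowr (nu \<alpha> (unit_cube_tower N :: (real ^ 'd) set set)) (1 / p1)
          = ennreal (real N powr (1 / p1))"
        and F: "F (unit_cube_tower N) = ennreal (real N powr recip q1)" if "0 < N" for N
        using Lp[OF unit_cube_tower_subset, of N] F_eq[OF unit_cube_tower_subset, of N] that assms \<alpha> \<beta>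
          Lp_norm_unit_cube_tower[OF assms(1) _ that, where ?'d = 'd]
        by (simp_all add: f_def[abs_def] recip_ennreal)
      \<comment> \<open>An infinite \<open>nu\<close> would have an infinite root, contradicting the
        value just found.\<close>
      have fin: "nu \<alpha> (unit_cube_tower N :: (real ^ 'd) set set) < \<infinity>" if "0 < N" for N
        using nu[OF that] by (cases "nu \<alpha> (unit_cube_tower N :: (real ^ 'd) set set) = \<infinity>")
          (auto simp: ennpowr_def less_top)
      have U: "real N powr recip q1 \<le> C * real N powr (1 / p1)" if "0 < N" for N
        using upper[OF unit_cube_tower_subset fin[OF that]] C
        by (simp add: nu[OF that] F[OF that] ennreal_mult'[symmetric])
      have L: "real N powr (1 / p1) \<le> C * real N powr recip q1" if "0 < N" for N
        using lower[OF unit_cube_tower_subset fin[OF that]] C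
        by (simp add: nu[OF that] F[OF that] ennreal_mult'[symmetric] inverse_eq_divide
            pos_divide_le_eq mult.commute[of _ C])
      \<comment> \<open>For \<open>j \<ge> 0\<close> this is the upper estimate with
        \<open>N = 2 ^ j\<close>; for \<open>j < 0\<close> it is the lower estimate with
        \<open>N = 2 ^ (- j)\<close>, after taking reciprocals.\<close>
      have "2 powr (of_int j * (recip q1)) \<le> C * 2 powr (of_int j * (1 / p1))" for j :: int
      proof (cases "0 \<le> j")
        case True
        then have "real (2 ^ nat j) = 2 powr of_int j"
          by (simp add: powr_realpow[symmetric])
        then show ?thesis using U[of "2 ^ nat j"] by (simp add: powr_powr)
      next
        case False
        then have "real (2 ^ nat (- j)) = 2 powr (- of_int j)"
          by (simp add: powr_realpow[symmetric])
        then have "2 powr (- (of_int j * (1 / p1))) \<le> C * 2 powr (- (of_int j * recip q1))"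
          using L[of "2 ^ nat (- j)"] by (simp add: powr_powr)
        then show ?thesis
          by (simp only: powr_minus) (simp add: inverse_eq_divide divide_simps mult.commute[of _ C])
      qed
      then have "recip q1 = 1 / p1" by (rule powr_quotient_bounded_imp_eq[OF C])
      \<comment> \<open>The value \<open>q1 = \<infinity>\<close> is excluded because its reciprocal
        is 0, while \<open>1 / p1\<close> is positive.\<close>
      then have "ennreal p1 = q1"
        using assms by (cases rule: ennreal_pos_cases[OF assms(3)]) (auto simp: recip_ennreal)
      then show ?thesis using True \<beta> by simp
    qed (use \<alpha> in simp)
  qed
  then show ?thesis
    unfolding P_def F_def c_def \<beta>_def d_def right_minus_eq .
qed

end
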